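(* Let $P$ be a set of $n \geq 3$ points in general position in the plane, and let $G$ be a geometric graph with vertex set $P$. If $s(G) \leq n-3$, then $G$ has a plane spanning tree.
   Context: A geometric graph with vertex set $P$ is a graph drawn in the plane so that each edge is the straight line segment joining its two endpoints in $P$. A plane spanning tree of $G$ is a subtree of $G$ containing every vertex of $G$ whose edges (as segments) pairwise do not cross, i.e. it is non-self-intersecting. Three points $u,v,w \in P$ form an empty triangle if no point of $P$ lies in the interior of the triangle $\triangle uvw$. An empty triangle $\triangle uvw$ of $P$ is disconnected in $G$ if the subgraph of $G$ induced by $\{u,v,w\}$ is not connected. $s(G)$ denotes the number of empty triangles of $P$ that are disconnected in $G$. *)

theory Defs
  imports "HOL-Analysis.Analysis"
begin

text \<open>
  Finite simple graphs are given by a vertex set \<open>V\<close> and a set \<open>E\<close> of two-element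
  vertex sets. The digraph-based notions of the Graph Theory AFP entry are not suitable here:
  there a tree may not contain a directed cycle, but every undirected edge, read as a pair of
  opposite arcs, is one.
\<close>

definition simple_graph :: "'a set \<Rightarrow> 'a set set \<Rightarrow> bool" where
  "simple_graph V E \<longleftrightarrow> finite V \<and> (\<forall>e\<in>E. e \<subseteq> V \<and> card e = 2)"

definition graph_connected :: "'a set \<Rightarrow> 'a set set \<Rightarrow> bool" where
  "graph_connected V E \<longleftrightarrow>
     V \<noteq> {} \<and> (\<forall>u\<in>V. \<forall>v\<in>V. (u, v) \<in> {(x, y). x \<in> V \<and> y \<in> V \<and> {x, y} \<in> E}\<^sup>*)"

definition graph_cycle :: "'a set set \<Rightarrow> 'a list \<Rightarrow> bool" where
  "graph_cycle E vs \<longleftrightarrow> length vs \<ge> 3 \<and> distinct vs \<and>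
     (\<forall>i<length vs. {vs ! i, vs ! (Suc i mod length vs)} \<in> E)"

definition graph_tree :: "'a set \<Rightarrow> 'a set set \<Rightarrow> bool" where
  "graph_tree V E \<longleftrightarrow> simple_graph V E \<and> graph_connected V E \<and> (\<nexists>vs. graph_cycle E vs)"

definition induced_edges :: "'a set set \<Rightarrow> 'a set \<Rightarrow> 'a set set" where
  "induced_edges E W = {e \<in> E. e \<subseteq> W}"

definition general_position :: "(real^2) set \<Rightarrow> bool" where
  "general_position P \<longleftrightarrow> (\<forall>t. t \<subseteq> P \<and> card t = 3 \<longrightarrow> \<not> collinear t)"

text \<open>
  A geometric graph on \<open>P\<close> is a simple graph \<open>(P, E)\<close> whose vertices are points of the plane;
  an edge \<open>e = {u, v}\<close> is drawn as \<open>convex hull e\<close>, which is \<open>closed_segment u v\<close>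
  (\<open>segment_convex_hull\<close>). Two edges do not cross if their segments meet at
  most in a common endpoint.
\<close>

definition plane_edges :: "(real^2) set set \<Rightarrow> bool" where
  "plane_edges E \<longleftrightarrow>
     (\<forall>e\<in>E. \<forall>f\<in>E. e \<noteq> f \<longrightarrow> convex hull e \<inter> convex hull f \<subseteq> e \<inter> f)"

definition plane_spanning_tree :: "(real^2) set \<Rightarrow> (real^2) set set \<Rightarrow> (real^2) set set \<Rightarrow> bool" where
  "plane_spanning_tree P E T \<longleftrightarrow> T \<subseteq> E \<and> graph_tree P T \<and> plane_edges T"

definition empty_triangles :: "(real^2) set \<Rightarrow> (real^2) set set" where
  "empty_triangles P = {t. t \<subseteq> P \<and> card t = 3 \<and> P \<inter> interior (convex hull t) = {}}"

definition disconnected_empty_triangles :: "(real^2) set \<Rightarrow> (real^2) set set \<Rightarrow> (real^2) set set" where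
  "disconnected_empty_triangles P E =
     {t \<in> empty_triangles P. \<not> graph_connected t (induced_edges E t)}"

definition s_number :: "(real^2) set \<Rightarrow> (real^2) set set \<Rightarrow> nat" where
  "s_number P E = card (disconnected_empty_triangles P E)"

end

theory Submission
  imports Defs
begin

text \<open>
  Induction on \<open>n = card P\<close>. Fix a hull vertex \<open>x\<close> and sort the other points \<open>p\<^sub>1, \<dots>, p\<^sub>m\<close>
  (\<open>m = n - 1\<close>) by angle around \<open>x\<close>. The line through \<open>x\<close> and \<open>p\<^sub>j\<close> cuts \<open>P\<close> into
  \<open>Q\<^sub>j = {x, p\<^sub>1, \<dots>, p\<^sub>j}\<close> and \<open>R\<^sub>j = {x, p\<^sub>j, \<dots>, p\<^sub>m}\<close>; connected plane subgraphs on
  \<open>Q\<^sub>j\<close> and \<open>R\<^sub>j\<close> unite to one on \<open>P\<close>. If no disconnected empty triangle contains \<open>x\<close>,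
  cutting repeatedly reduces \<open>P\<close> to single triangles at \<open>x\<close>. Otherwise the induction hypothesis
  applies to \<open>P - {x}\<close>, so we are done if \<open>x\<close> is adjacent to an endpoint of a hull edge
  \<open>pq\<close> of \<open>P - {x}\<close> that is visible from \<open>x\<close>. If it never is, every such triangle \<open>xpq\<close>
  is empty and disconnected, and \<open>s(Q\<^sub>j) \<ge> j - 1\<close> follows by induction on \<open>j\<close>: take the visible
  edge \<open>pq\<close> over the gap between \<open>p\<^sub>j\<close> and \<open>p\<^sub>j\<^sub>+\<^sub>1\<close>. If \<open>q = p\<^sub>j\<^sub>+\<^sub>1\<close>, then \<open>xpq\<close> is new in
  \<open>Q\<^sub>j\<^sub>+\<^sub>1\<close>. Otherwise \<open>xpq\<close> is counted neither in \<open>Q\<^sub>j\<^sub>+\<^sub>1\<close> nor in \<open>R\<^sub>j\<^sub>+\<^sub>1\<close>, so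
  \<open>s(Q\<^sub>j\<^sub>+\<^sub>1) = j - 1\<close> would make both parts satisfy the hypothesis of the theorem.
  For \<open>j = m\<close> this contradicts \<open>s(P) \<le> n - 3\<close>.
\<close>

section \<open>Connected graphs\<close>

abbreviation adjacency :: "'a set \<Rightarrow> 'a set set \<Rightarrow> ('a \<times> 'a) set" where
  "adjacency V E \<equiv> {(x, y). x \<in> V \<and> y \<in> V \<and> {x, y} \<in> E}"

lemma sym_rtrancl_adjacency: "sym ((adjacency V E)\<^sup>*)"
  by (rule sym_rtrancl) (auto simp: sym_def insert_commute)

lemma graph_connected_from:
  assumes "x \<in> V" and "\<And>v. v \<in> V \<Longrightarrow> (x, v) \<in> (adjacency V E)\<^sup>*"
  shows "graph_connected V E"
proof -
  have "(u, v) \<in> (adjacency V E)\<^sup>*" if "u \<in> V" "v \<in> V" for u v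
    using assms(2)[OF that(1)] assms(2)[OF that(2)] sym_rtrancl_adjacency[of V E]
    by (meson rtrancl_trans symD)
  then show ?thesis using assms(1) by (auto simp: graph_connected_def)
qed

lemma graph_connected_Un:
  assumes "graph_connected Q E" "graph_connected R F" "x \<in> Q" "x \<in> R"
  shows "graph_connected (Q \<union> R) (E \<union> F)"
proof (rule graph_connected_from[of x])
  fix v assume v: "v \<in> Q \<union> R"
  have "(adjacency Q E)\<^sup>* \<subseteq> (adjacency (Q \<union> R) (E \<union> F))\<^sup>*"
    "(adjacency R F)\<^sup>* \<subseteq> (adjacency (Q \<union> R) (E \<union> F))\<^sup>*"
    by (rule rtrancl_mono; auto)+
  then show "(x, v) \<in> (adjacency (Q \<union> R) (E \<union> F))\<^sup>*"
    using v assms unfolding graph_connected_def by blast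
qed (use assms in auto)

lemma graph_connected_edge: "graph_connected {x, v} {{x, v}}"
proof (rule graph_connected_from[of x])
  have "(x, v) \<in> adjacency {x, v} {{x, v}}" by simp
  then show "(x, u) \<in> (adjacency {x, v} {{x, v}})\<^sup>*" if "u \<in> {x, v}" for u
    using that by (auto intro: r_into_rtrancl)
qed simp

lemma not_graph_connected_isolated:
  assumes "x \<in> V" "p \<in> V" "x \<noteq> p" and "\<And>z. z \<in> V \<Longrightarrow> {x, z} \<notin> E"
  shows "\<not> graph_connected V E"
proof
  assume "graph_connected V E"
  then have "(x, p) \<in> (adjacency V E)\<^sup>*" using assms by (auto simp: graph_connected_def)
  then show False using assms(3,4) by (cases rule: converse_rtranclE) auto
qed

text \<open>The rest of the cycle is a path between the ends of the removed closing edge, so every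
  walk can bypass that edge.\<close>

lemma graph_connected_remove_cycle_edge:
  assumes con: "graph_connected V E" and cyc: "graph_cycle E vs" and sub: "\<And>e. e \<in> E \<Longrightarrow> e \<subseteq> V"
  shows "graph_connected V (E - {{hd vs, last vs}})"
proof -
  let ?F = "E - {{hd vs, last vs}}"
  let ?k = "length vs"
  have k: "?k \<ge> 3" and d: "distinct vs"
    and ed: "\<And>i. i < ?k \<Longrightarrow> {vs ! i, vs ! (Suc i mod ?k)} \<in> E"
    using cyc by (auto simp: graph_cycle_def)
  have ends: "hd vs = vs ! 0" "last vs = vs ! (?k - 1)"
    using k by (auto simp: hd_conv_nth last_conv_nth simp flip: length_greater_0_conv)
  have path: "i < ?k \<Longrightarrow> (vs ! 0, vs ! i) \<in> (adjacency V ?F)\<^sup>*" for i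
  proof (induction i)
    case (Suc i)
    have e: "{vs ! i, vs ! Suc i} \<in> E" using ed[of i] Suc.prems by simp
    \<comment> \<open>By distinctness, equality would force \<open>i = 0\<close> and
      \<open>Suc i = ?k - 1\<close>, impossible for a cycle of length at least 3, or else
      \<open>Suc i = 0\<close>.\<close>
    have "{vs ! i, vs ! Suc i} \<noteq> {vs ! 0, vs ! (?k - 1)}"
    proof
      assume "{vs ! i, vs ! Suc i} = {vs ! 0, vs ! (?k - 1)}"
      then have "(vs ! i = vs ! 0 \<and> vs ! Suc i = vs ! (?k - 1)) \<or>
          (vs ! i = vs ! (?k - 1) \<and> vs ! Suc i = vs ! 0)"
        by (auto simp: doubleton_eq_iff)
      then show False
      proof
        assume *: "vs ! i = vs ! 0 \<and> vs ! Suc i = vs ! (?k - 1)"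
        then have "i = 0" using nth_eq_iff_index_eq[OF d, of i 0] Suc.prems k by fastforce
        moreover have "Suc i = ?k - 1"
          using * nth_eq_iff_index_eq[OF d, of "Suc i" "?k - 1"] Suc.prems by simp
        ultimately show False using k by simp
      next
        assume "vs ! i = vs ! (?k - 1) \<and> vs ! Suc i = vs ! 0"
        then show False using nth_eq_iff_index_eq[OF d, of "Suc i" 0] Suc.prems by fastforce
      qed
    qed
    then have "(vs ! i, vs ! Suc i) \<in> adjacency V ?F" using e sub[OF e] ends by auto
    with Suc show ?case by (auto intro: rtrancl_into_rtrancl)
  qed simp
  have hl: "(hd vs, last vs) \<in> (adjacency V ?F)\<^sup>*"
    using path[of "?k - 1"] k by (simp add: ends)
  have lh: "(last vs, hd vs) \<in> (adjacency V ?F)\<^sup>*"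
    by (rule symD[OF sym_rtrancl_adjacency hl])
  have "adjacency V E \<subseteq> (adjacency V ?F)\<^sup>*"
    using hl lh by (auto simp: doubleton_eq_iff)
  then have "(adjacency V E)\<^sup>* \<subseteq> (adjacency V ?F)\<^sup>*"
    by (rule rtrancl_subset_rtrancl)
  then show ?thesis using con by (auto simp: graph_connected_def)
qed

text \<open>A connected spanning subgraph with the fewest edges has no cycle, since a cycle edge
  could be dropped.\<close>

lemma graph_connected_imp_spanning_tree:
  assumes "graph_connected V E" "simple_graph V E"
  shows "\<exists>T\<subseteq>E. graph_tree V T"
proof -
  have fin: "finite E"
    using assms(2) by (auto simp: simple_graph_def intro!: finite_subset[of E "Pow V"])
  obtain T where T: "T \<subseteq> E" "graph_connected V T"
    and min: "\<And>T'. T' \<subseteq> E \<Longrightarrow> graph_connected V T' \<Longrightarrow> card T \<le> card T'"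
    using ex_has_least_nat[of "\<lambda>T. T \<subseteq> E \<and> graph_connected V T" E card] assms(1) by auto
  have "\<not> graph_cycle T vs" for vs
  proof
    assume c: "graph_cycle T vs"
    have "graph_connected V (T - {{hd vs, last vs}})"
      using T c assms(2) by (intro graph_connected_remove_cycle_edge) (auto simp: simple_graph_def)
    from min[OF _ this] T have "card T \<le> card (T - {{hd vs, last vs}})" by auto
    moreover have "{hd vs, last vs} \<in> T"
    proof -
      have k: "length vs \<ge> 3" using c by (simp add: graph_cycle_def)
      \<comment> \<open>At the last index the successor modulo the length wraps around to 0, which
        gives the closing edge.\<close>
      then have "{vs ! (length vs - 1), vs ! (Suc (length vs - 1) mod length vs)} \<in> T"
        using c unfolding graph_cycle_def by (metis diff_less less_le_trans zero_less_numeral zero_less_one)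
      moreover have "vs \<noteq> []" "Suc (length vs - 1) = length vs" using k by auto
      ultimately show ?thesis
        by (simp add: hd_conv_nth last_conv_nth insert_commute)
    qed
    ultimately show False
      using T(1) fin by (metis card_Diff1_less finite_subset not_less)
  qed
  moreover have "simple_graph V T" using T(1) assms(2) by (auto simp: simple_graph_def)
  ultimately show ?thesis unfolding graph_tree_def using T by blast
qed

section \<open>Plane connected spanning subgraphs\<close>

text \<open>Acyclicity is left out so that pieces can be glued freely; a tree is extracted only at
  the very end.\<close>

definition plane_connectable :: "(real^2) set set \<Rightarrow> (real^2) set \<Rightarrow> bool" where
  "plane_connectable E S \<longleftrightarrow>
     (\<exists>H\<subseteq>E. (\<forall>e\<in>H. e \<subseteq> S) \<and> graph_connected S H \<and> plane_edges H)"

text \<open>An affine function that is not constantly maximal on a segment attains its bound at most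
  at an endpoint.\<close>

lemma edge_meets_supporting_line:
  fixes h :: "real^2"
  assumes "card e = 2" "\<And>z. z \<in> e \<Longrightarrow> h \<bullet> z \<le> b" "\<not> (\<forall>z\<in>e. h \<bullet> z = b)"
    and z: "z \<in> convex hull e" "h \<bullet> z = b"
  shows "z \<in> e"
proof -
  have *: "z \<in> {u, v}" if u: "h \<bullet> u < b" and v: "h \<bullet> v \<le> b" and zz: "z \<in> closed_segment u v" for u v
  proof -
    obtain l where l: "0 \<le> l" "l \<le> 1" "z = (1 - l) *\<^sub>R u + l *\<^sub>R v"
      using zz by (auto simp: in_segment)
    have "h \<bullet> z = (1 - l) * (h \<bullet> u) + l * (h \<bullet> v)" by (simp add: l inner_simps)
    then have "(1 - l) * (b - h \<bullet> u) + l * (b - h \<bullet> v) = 0" using z(2) by (simp add: algebra_simps)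
    moreover have "(1 - l) * (b - h \<bullet> u) \<ge> 0" "l * (b - h \<bullet> v) \<ge> 0" using l u v by auto
    ultimately have "(1 - l) * (b - h \<bullet> u) = 0" by linarith
    then have "l = 1" using u by auto
    then show ?thesis using l by simp
  qed
  obtain u v where e: "e = {u, v}" using assms(1) by (auto simp: card_2_iff)
  have "z \<in> closed_segment u v" using z(1) e by (simp add: segment_convex_hull)
  then show ?thesis
    using *[of u v] *[of v u] assms(2)[of u] assms(2)[of v] assms(3) e
    by (auto simp: closed_segment_commute)
qed

lemma inner_le_on_hull:
  fixes h :: "real^2"
  assumes "z \<in> convex hull S" "\<And>p. p \<in> S \<Longrightarrow> h \<bullet> p \<le> b"
  shows "h \<bullet> z \<le> b"
proof -
  have "convex hull S \<subseteq> {z. h \<bullet> z \<le> b}"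
    by (rule hull_minimal) (use assms(2) in \<open>auto simp: convex_halfspace_le\<close>)
  then show ?thesis using assms(1) by auto
qed

text \<open>A common point lies on the separating line. Each edge meets that line only in an
  endpoint, unless it lies in the line and is \<open>{x, y}\<close>; this cannot happen to both
  edges.\<close>

lemma edges_on_opposite_sides_meet:
  fixes h :: "real^2"
  assumes e: "card e = 2" "\<And>z. z \<in> e \<Longrightarrow> h \<bullet> z \<le> b"
    and f: "card f = 2" "\<And>z. z \<in> f \<Longrightarrow> h \<bullet> z \<ge> b"
    and L: "{z \<in> e \<union> f. h \<bullet> z = b} \<subseteq> {x, y}" and "e \<noteq> f"
  shows "convex hull e \<inter> convex hull f \<subseteq> e \<inter> f"
proof
  fix z assume "z \<in> convex hull e \<inter> convex hull f"
  then have z: "z \<in> convex hull e" "z \<in> convex hull f" by auto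
  have hz: "h \<bullet> z = b"
    using inner_le_on_hull[OF z(1), of h b] inner_le_on_hull[OF z(2), of "- h" "- b"] e f by force
  have flat: "g = {x, y}" if "g \<subseteq> e \<union> f" "card g = 2" "\<forall>z\<in>g. h \<bullet> z = b" for g
  proof -
    have "g \<subseteq> {x, y}" using that L by auto
    moreover have "card {x, y} \<le> 2" by (simp add: card_insert_if)
    ultimately show ?thesis using that(2) by (simp add: card_seteq)
  qed
  have 1: "z \<in> e \<or> e = {x, y}"
    using edge_meets_supporting_line[OF e(1), of h b z] e(2) z(1) hz flat[of e] e(1) by auto
  have 2: "z \<in> f \<or> f = {x, y}"
    using edge_meets_supporting_line[OF f(1), of "- h" "- b" z] f(2) z(2) hz flat[of f] f(1) by auto
  show "z \<in> e \<inter> f" using 1 2 L hz \<open>e \<noteq> f\<close> by blast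
qed

lemma plane_edges_Un:
  assumes "plane_edges H" "plane_edges K"
    and "\<And>e f. e \<in> H \<Longrightarrow> f \<in> K \<Longrightarrow> e \<noteq> f \<Longrightarrow> convex hull e \<inter> convex hull f \<subseteq> e \<inter> f"
  shows "plane_edges (H \<union> K)"
  using assms unfolding plane_edges_def by (metis Int_commute Un_iff)

lemma plane_connectable_split:
  assumes E: "\<And>e. e \<in> E \<Longrightarrow> card e = 2"
    and Q: "plane_connectable E Q" "\<And>z. z \<in> Q \<Longrightarrow> h \<bullet> z \<le> b"
    and R: "plane_connectable E R" "\<And>z. z \<in> R \<Longrightarrow> h \<bullet> z \<ge> b"
    and L: "{z \<in> Q \<union> R. h \<bullet> z = b} \<subseteq> {x, y}" and x: "x \<in> Q" "x \<in> R"
  shows "plane_connectable E (Q \<union> R)"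
proof -
  obtain H where H: "H \<subseteq> E" "\<forall>e\<in>H. e \<subseteq> Q" "graph_connected Q H" "plane_edges H"
    using Q(1) by (auto simp: plane_connectable_def)
  obtain K where K: "K \<subseteq> E" "\<forall>e\<in>K. e \<subseteq> R" "graph_connected R K" "plane_edges K"
    using R(1) by (auto simp: plane_connectable_def)
  have "plane_edges (H \<union> K)"
  proof (rule plane_edges_Un[OF H(4) K(4)])
    fix e f assume ef: "e \<in> H" "f \<in> K" "e \<noteq> f"
    then have "e \<subseteq> Q" "f \<subseteq> R" using H K by auto
    then show "convex hull e \<inter> convex hull f \<subseteq> e \<inter> f"
      using ef E H(1) K(1) Q(2) R(2) L
      by (intro edges_on_opposite_sides_meet[where h = h and b = b and x = x and y = y]) blast+
  qed
  then show ?thesis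
    unfolding plane_connectable_def
    using H K graph_connected_Un[OF H(3) K(3) x] by (intro exI[of _ "H \<union> K"]) auto
qed

lemma general_position_subset: "general_position P \<Longrightarrow> S \<subseteq> P \<Longrightarrow> general_position S"
  by (auto simp: general_position_def)

lemma general_position_triple:
  assumes "general_position P" "{a, b, c} \<subseteq> P" "a \<noteq> b" "a \<noteq> c" "b \<noteq> c"
  shows "\<not> collinear {a, b, c}"
proof -
  have "card {a, b, c} = 3" using assms by auto
  then show ?thesis using assms(1,2) unfolding general_position_def by blast
qed

text \<open>The line of height \<open>h \<bullet> v\<close> separates \<open>x\<close> from
  \<open>S\<close>, so the new edge meets old ones only in \<open>v\<close>. General position keeps
  \<open>v\<close> out of the relative interior of an old edge.\<close>

lemma plane_connectable_pendant:
  assumes E: "\<And>e. e \<in> E \<Longrightarrow> card e = 2" and gp: "general_position S"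
    and S: "plane_connectable E S" "\<And>z. z \<in> S \<Longrightarrow> h \<bullet> z \<ge> h \<bullet> v"
    and v: "v \<in> S" and x: "h \<bullet> x < h \<bullet> v" and xv: "{x, v} \<in> E"
  shows "plane_connectable E (insert x S)"
proof -
  obtain H where H: "H \<subseteq> E" "\<forall>e\<in>H. e \<subseteq> S" "graph_connected S H" "plane_edges H"
    using S(1) by (auto simp: plane_connectable_def)
  have "plane_edges ({{x, v}} \<union> H)"
  proof (rule plane_edges_Un[OF _ H(4)])
    fix e f assume ef: "e \<in> {{x, v}}" "f \<in> H" "e \<noteq> f"
    have fS: "f \<subseteq> S" "card f = 2" using ef H E by auto
    show "convex hull e \<inter> convex hull f \<subseteq> e \<inter> f"
    proof
      fix z assume "z \<in> convex hull e \<inter> convex hull f"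
      then have z: "z \<in> convex hull {x, v}" "z \<in> convex hull f" using ef by auto
      have "h \<bullet> z \<ge> h \<bullet> v"
        using inner_le_on_hull[OF z(2), of "- h" "- (h \<bullet> v)"] S(2) fS by auto
      moreover have "h \<bullet> z \<le> h \<bullet> v"
        by (rule inner_le_on_hull[OF z(1)]) (use x in auto)
      ultimately have hz: "h \<bullet> z = h \<bullet> v" by simp
      have "z \<in> {x, v}"
        by (rule edge_meets_supporting_line[of _ h "h \<bullet> v"]) (use z(1) hz x E[OF xv] in auto)
      then have zv: "z = v" using hz x by auto
      obtain a c where ac: "f = {a, c}" "a \<noteq> c" using fS(2) by (auto simp: card_2_iff)
      have "v \<in> f"
      proof (rule ccontr)
        assume "v \<notin> f"
        then have "\<not> collinear {a, v, c}"
          using ac fS v by (intro general_position_triple[OF gp]) auto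
        moreover have "between (a, c) v"
          using z(2) zv ac by (simp add: between_mem_segment segment_convex_hull)
        ultimately show False using between_imp_collinear by blast
      qed
      then show "z \<in> e \<inter> f" using zv ef by auto
    qed
  qed (auto simp: plane_edges_def)
  then show ?thesis
    unfolding plane_connectable_def
    using H xv v graph_connected_Un[OF graph_connected_edge[of x v] H(3), of v]
    by (intro exI[of _ "{{x, v}} \<union> H"]) (auto simp: insert_absorb)
qed

text \<open>Two distinct edges on three vertices share a vertex and, by non-collinearity, meet
  nowhere else.\<close>

lemma plane_connectable_triangle:
  assumes E: "\<And>e. e \<in> E \<Longrightarrow> card e = 2" and gp: "general_position t" and "card t = 3"
    and con: "graph_connected t (induced_edges E t)"
  shows "plane_connectable E t"
proof -
  have "plane_edges (induced_edges E t)"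
    unfolding plane_edges_def
  proof (intro ballI impI)
    fix e f assume ef: "e \<in> induced_edges E t" "f \<in> induced_edges E t" "e \<noteq> f"
    have fin: "finite t" using \<open>card t = 3\<close> by (metis card.infinite zero_neq_numeral)
    have c: "card e = 2" "card f = 2" "e \<subseteq> t" "f \<subseteq> t" using ef E by (auto simp: induced_edges_def)
    have fe: "finite e" "finite f" using c fin finite_subset by auto
    have "card (e \<union> f) \<le> 3" using card_mono[OF fin, of "e \<union> f"] c assms(3) by auto
    then have "e \<inter> f \<noteq> {}"
      using card_Un_Int[OF fe] c by auto
    then obtain b where b: "b \<in> e" "b \<in> f" by auto
    obtain a where a: "e = {a, b}" "a \<noteq> b"
      using b(1) c(1) by (auto simp: card_2_iff)
    obtain d where d: "f = {b, d}" "b \<noteq> d"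
      using b(2) c(2) by (auto simp: card_2_iff)
    have "a \<noteq> d" using a d ef(3) by auto
    then have "\<not> collinear {a, b, d}"
      using a d c by (intro general_position_triple[OF gp]) auto
    then have "closed_segment a b \<inter> closed_segment b d = {b}" by (simp add: Int_closed_segment)
    then show "convex hull e \<inter> convex hull f \<subseteq> e \<inter> f"
      using a d by (auto simp: segment_convex_hull)
  qed
  then show ?thesis using con unfolding plane_connectable_def
    by (intro exI[of _ "induced_edges E t"]) (auto simp: induced_edges_def)
qed

section \<open>Points seen from a hull vertex\<close>

lemma ex_maximizer:
  fixes f :: "'a \<Rightarrow> real"
  assumes "finite A" "A \<noteq> {}"
  shows "\<exists>a\<in>A. \<forall>b\<in>A. f b \<le> f a"
proof -
  have "Max (f ` A) \<in> f ` A" using assms by (intro Max_in) auto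
  then obtain a where "a \<in> A" "f a = Max (f ` A)" by auto
  then show ?thesis using assms by (metis Max_ge finite_imageI imageI)
qed

text \<open>This finds the edge of the upper hull of the points \<open>(t z, w z)\<close> over
  \<open>t0\<close>: among all chords crossing the vertical line at \<open>t0\<close>, take one that
  crosses it highest. A point above that chord's line could replace the endpoint on its own side and
  raise the crossing.\<close>

lemma supporting_pair:
  fixes t w :: "'a \<Rightarrow> real"
  assumes fin: "finite S" and l: "p0 \<in> S" "t p0 < t0" and r: "q0 \<in> S" "t0 < t q0"
    and ne: "\<And>z. z \<in> S \<Longrightarrow> t z \<noteq> t0"
  shows "\<exists>p\<in>S. \<exists>q\<in>S. \<exists>A B. t p < t0 \<and> t0 < t q \<and> w p = A + B * t p \<and> w q = A + B * t q \<and>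
    (\<forall>z\<in>S. w z \<le> A + B * t z)"
proof -
  \<comment> \<open>The value at \<open>t0\<close> of the line through the points of
    \<open>p\<close> and \<open>q\<close>.\<close>
  define height where "height = (\<lambda>(p, q). (w p * (t q - t0) + w q * (t0 - t p)) / (t q - t p))"
  define C where "C = {p \<in> S. t p < t0} \<times> {q \<in> S. t0 < t q}"
  have C: "finite C" "C \<noteq> {}" using fin l r by (auto simp: C_def)
  then obtain pq where "pq \<in> C" and mx: "\<And>z. z \<in> C \<Longrightarrow> height z \<le> height pq"
    using ex_maximizer[of C height] by blast
  then obtain p q where p: "p \<in> S" "t p < t0" and q: "q \<in> S" "t0 < t q" and pq: "pq = (p, q)"
    by (auto simp: C_def)
  define B where "B = (w q - w p) / (t q - t p)"
  define A where "A = w p - B * t p"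
  have wp: "w p = A + B * t p" by (simp add: A_def)
  have "B * (t q - t p) = w q - w p" using p q by (simp add: B_def)
  then have wq: "w q = A + B * t q" by (simp add: A_def algebra_simps)
  have line: "(A + B * u) * (v - t0) + (A + B * v) * (t0 - u) = (A + B * t0) * (v - u)" for u v
    by (simp add: algebra_simps)
  have "height (p, q) = A + B * t0"
    using p q unfolding height_def prod.case wp wq line by simp
  then have mx': "height (a, b) \<le> A + B * t0" if "(a, b) \<in> C" for a b using mx[OF that] pq by simp
  have "w z \<le> A + B * t z" if z: "z \<in> S" for z
  proof (rule ccontr)
    assume "\<not> w z \<le> A + B * t z"
    then have gt: "w z > A + B * t z" by simp
    show False
    proof (cases "t z < t0")
      case True
      have "w z * (t q - t0) > (A + B * t z) * (t q - t0)" using gt q by simp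
      then have "w z * (t q - t0) + w q * (t0 - t z) > (A + B * t0) * (t q - t z)"
        using line[of "t z" "t q"] wq by simp
      then have "height (z, q) > A + B * t0"
        using True q by (simp add: height_def pos_less_divide_eq)
      moreover have "(z, q) \<in> C" using True q z by (simp add: C_def)
      ultimately show False using mx' by fastforce
    next
      case False
      then have tz: "t0 < t z" using ne[OF z] by simp
      have "w z * (t0 - t p) > (A + B * t z) * (t0 - t p)" using gt p by simp
      then have "w p * (t z - t0) + w z * (t0 - t p) > (A + B * t0) * (t z - t p)"
        using line[of "t p" "t z"] wp by simp
      then have "height (p, z) > A + B * t0"
        using tz p by (simp add: height_def pos_less_divide_eq)
      moreover have "(p, z) \<in> C" using tz p z by (simp add: C_def)
      ultimately show False using mx' by fastforce
    qed
  qed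
  then show ?thesis using p q wp wq by blast
qed

section \<open>Empty triangles of subsets cut off by a line\<close>

text \<open>The interior of a triangle of \<open>S\<close> lies strictly on the side of the line
  where \<open>P\<close> and \<open>S\<close> agree, so no further point of \<open>P\<close> can
  enter it.\<close>

lemma empty_triangles_cut:
  assumes "S \<subseteq> P" "h \<noteq> 0" and S: "\<And>p. p \<in> S \<Longrightarrow> h \<bullet> p \<le> b"
    and P: "\<And>p. p \<in> P \<Longrightarrow> h \<bullet> p < b \<Longrightarrow> p \<in> S"
  shows "empty_triangles S \<subseteq> empty_triangles P"
proof
  fix t assume t: "t \<in> empty_triangles S"
  then have tS: "t \<subseteq> S" by (auto simp: empty_triangles_def)
  have "convex hull t \<subseteq> {z. h \<bullet> z \<le> b}"
    by (rule hull_minimal) (use tS S in \<open>auto simp: convex_halfspace_le\<close>)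
  then have "interior (convex hull t) \<subseteq> {z. h \<bullet> z < b}"
    using interior_mono interior_halfspace_le[OF \<open>h \<noteq> 0\<close>] by metis
  then show "t \<in> empty_triangles P"
    using t P \<open>S \<subseteq> P\<close> unfolding empty_triangles_def by blast
qed

lemma triangle_vertex_not_interior:
  assumes "general_position P" "t \<subseteq> P" "card t = 3" "z \<in> t"
  shows "z \<notin> interior (convex hull t)"
proof -
  obtain a b c where t: "t = {a, b, c}" "a \<noteq> b" "a \<noteq> c" "b \<noteq> c"
    using assms(3) by (auto simp: card_3_iff)
  have "\<not> affine_dependent t"
    using general_position_triple[OF assms(1), of a b c] assms(2) t
    by (auto simp: collinear_3_eq_affine_dependent)
  then show ?thesis
    using assms(4) extreme_point_not_in_interior extreme_point_of_convex_hull_affine_independent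
    by blast
qed

lemma empty_triangles_restrict:
  "t \<in> empty_triangles P \<Longrightarrow> t \<subseteq> S \<Longrightarrow> S \<subseteq> P \<Longrightarrow> t \<in> empty_triangles S"
  by (auto simp: empty_triangles_def)

lemma finite_disconnected_empty_triangles:
  "finite P \<Longrightarrow> finite (disconnected_empty_triangles P E)"
  by (rule finite_subset[of _ "Pow P"])
    (auto simp: disconnected_empty_triangles_def empty_triangles_def)

lemma disconnected_empty_triangles_mono:
  "empty_triangles S \<subseteq> empty_triangles P \<Longrightarrow>
    disconnected_empty_triangles S E \<subseteq> disconnected_empty_triangles P E"
  by (auto simp: disconnected_empty_triangles_def)

text \<open>Rotation by a quarter turn.\<close>

definition perp :: "real^2 \<Rightarrow> real^2" where
  "perp d = vector [- (d $ 2), d $ 1]"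

lemma inner_perp [simp]: "d \<bullet> perp d = 0" "perp d \<bullet> d = 0"
  by (simp_all add: perp_def inner_vec_def sum_2)

lemma perp_eq_0 [simp]: "perp d = 0 \<longleftrightarrow> d = 0"
  by (auto simp: perp_def vec_eq_iff forall_2)

lemma collinear_on_line:
  fixes h :: "real^2"
  assumes "h \<noteq> 0" "\<And>z. z \<in> S \<Longrightarrow> h \<bullet> z = b"
  shows "collinear S"
proof -
  have "S \<subseteq> {z. h \<bullet> z = b}" using assms(2) by auto
  then have "aff_dim S \<le> aff_dim {z. h \<bullet> z = b}" by (rule aff_dim_subset)
  then show ?thesis using assms(1) by (simp add: collinear_aff_dim)
qed

section \<open>Angular order around a hull vertex\<close>

text \<open>The direction \<open>d\<close> certifies that \<open>x\<close> is a hull vertex;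
  positivity also makes it a legitimate denominator for slopes.\<close>

locale hull_vertex =
  fixes P :: "(real^2) set" and x d :: "real^2"
  assumes fin: "finite P" and gp: "general_position P" and x: "x \<in> P"
    and pos: "\<And>p. p \<in> P \<Longrightarrow> p \<noteq> x \<Longrightarrow> d \<bullet> (p - x) > 0"

text \<open>A point farthest from the origin works, with \<open>d\<close> pointing back to the
  origin.\<close>

lemma ex_hull_vertex:
  assumes "finite P" "P \<noteq> {}" "general_position P"
  shows "\<exists>x d. hull_vertex P x d"
proof -
  obtain x where x: "x \<in> P" and mx: "\<And>p. p \<in> P \<Longrightarrow> norm p \<le> norm x"
    using ex_maximizer[of P norm] assms(1,2) by blast
  have "(- x) \<bullet> (p - x) > 0" if "p \<in> P" "p \<noteq> x" for p
  proof -
    have "0 < (norm (p - x))\<^sup>2" using that by simp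
    also have "\<dots> = p \<bullet> p + x \<bullet> x - 2 * (x \<bullet> p)"
      by (simp add: power2_norm_eq_inner inner_diff algebra_simps inner_commute)
    also have "p \<bullet> p \<le> x \<bullet> x"
      using mx[OF that(1)] by (simp add: norm_le)
    finally show ?thesis by (simp add: inner_diff_right)
  qed
  then have "hull_vertex P x (- x)" using assms x unfolding hull_vertex_def by blast
  then show ?thesis by blast
qed

context hull_vertex
begin

lemma subset: "S \<subseteq> P \<Longrightarrow> x \<in> S \<Longrightarrow> hull_vertex S x d"
  using fin gp pos general_position_subset finite_subset unfolding hull_vertex_def by blast

text \<open>Sorting by slope is sorting by angle around \<open>x\<close>.\<close>

definition slope :: "real^2 \<Rightarrow> real" where
  "slope p = (perp d \<bullet> (p - x)) / (d \<bullet> (p - x))"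

text \<open>Normal vector of the line through \<open>x\<close> of slope \<open>t\<close>; the sign
  of \<open>normal t \<bullet> (p - x)\<close> compares \<open>slope p\<close> with
  \<open>t\<close>.\<close>

definition normal :: "real \<Rightarrow> real^2" where
  "normal t = perp d - t *\<^sub>R d"

text \<open>For \<open>y\<close> the j-th point in angular order, \<open>below y\<close> and
  \<open>above y\<close> are the two parts cut by the line through \<open>x\<close> and
  \<open>y\<close>; both keep \<open>x\<close> and \<open>y\<close>.\<close>

definition below :: "real^2 \<Rightarrow> (real^2) set" where
  "below y = insert x {p \<in> P - {x}. slope p \<le> slope y}"

definition above :: "real^2 \<Rightarrow> (real^2) set" where
  "above y = insert x {p \<in> P - {x}. slope y \<le> slope p}"

definition strictly_below :: "real^2 \<Rightarrow> (real^2) set" where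
  "strictly_below y = {p \<in> P - {x}. slope p < slope y}"

lemma normal_eq_0: "normal t = 0 \<longleftrightarrow> d = 0"
proof
  assume "normal t = 0"
  then have "normal t \<bullet> perp d = 0" by simp
  then have "perp d \<bullet> perp d = 0" by (simp add: normal_def inner_diff_left)
  then show "d = 0" by simp
qed (simp add: normal_def perp_def vec_eq_iff forall_2)

lemma inner_normal:
  assumes "p \<in> P" "p \<noteq> x"
  shows "normal t \<bullet> (p - x) = (slope p - t) * (d \<bullet> (p - x))"
  using pos[OF assms] by (simp add: normal_def slope_def inner_diff_left left_diff_distrib)

lemma d_neq_0: "p \<in> P \<Longrightarrow> p \<noteq> x \<Longrightarrow> d \<noteq> 0"
  using pos by fastforce

lemma inner_normal_sign:
  assumes "p \<in> P" "p \<noteq> x"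
  shows "normal t \<bullet> p \<le> normal t \<bullet> x \<longleftrightarrow> slope p \<le> t"
    and "normal t \<bullet> x \<le> normal t \<bullet> p \<longleftrightarrow> t \<le> slope p"
    and "normal t \<bullet> p = normal t \<bullet> x \<longleftrightarrow> slope p = t"
proof -
  have e: "normal t \<bullet> p - normal t \<bullet> x = (slope p - t) * (d \<bullet> (p - x))"
    using inner_normal[OF assms] by (simp add: inner_diff_right)
  have a: "d \<bullet> (p - x) > 0" using pos[OF assms] .
  have "(slope p - t) * (d \<bullet> (p - x)) \<le> 0 \<longleftrightarrow> slope p \<le> t"
    "0 \<le> (slope p - t) * (d \<bullet> (p - x)) \<longleftrightarrow> t \<le> slope p"
    "(slope p - t) * (d \<bullet> (p - x)) = 0 \<longleftrightarrow> slope p = t"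
    using a by (simp_all add: mult_le_0_iff zero_le_mult_iff)
  then show "normal t \<bullet> p \<le> normal t \<bullet> x \<longleftrightarrow> slope p \<le> t"
    "normal t \<bullet> x \<le> normal t \<bullet> p \<longleftrightarrow> t \<le> slope p"
    "normal t \<bullet> p = normal t \<bullet> x \<longleftrightarrow> slope p = t"
    unfolding e[symmetric] by linarith+
qed

lemma slope_inj:
  assumes "p \<in> P" "p \<noteq> x" "q \<in> P" "q \<noteq> x" "slope p = slope q"
  shows "p = q"
proof (rule ccontr)
  assume "p \<noteq> q"
  have "collinear {x, p, q}"
    by (rule collinear_on_line[of "normal (slope p)" _ "normal (slope p) \<bullet> x"])
      (use assms inner_normal_sign(3)[of _ "slope p"] d_neq_0[of p] in \<open>auto simp: normal_eq_0\<close>)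
  moreover have "\<not> collinear {x, p, q}"
    using assms \<open>p \<noteq> q\<close> x by (intro general_position_triple[OF gp]) auto
  ultimately show False by simp
qed

lemma below_subset: "below y \<subseteq> P" and above_subset: "above y \<subseteq> P"
  using x by (auto simp: below_def above_def)

lemma below_Un_above: "below y \<union> above y = P"
  using x by (auto simp: below_def above_def)

lemma below_Int_above: "y \<in> P \<Longrightarrow> y \<noteq> x \<Longrightarrow> below y \<inter> above y = {x, y}"
  using slope_inj[of _ y] by (fastforce simp: below_def above_def)

lemma card_below:
  assumes "y \<in> P" "y \<noteq> x"
  shows "card (below y) = card (strictly_below y) + 2"
proof -
  have "below y = insert x (insert y (strictly_below y))"
    using assms slope_inj[of _ y] by (force simp: below_def strictly_below_def)
  moreover have "finite (strictly_below y)" using fin by (simp add: strictly_below_def)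
  ultimately show ?thesis using assms by (simp add: strictly_below_def)
qed

lemma card_below_above:
  assumes "y \<in> P" "y \<noteq> x"
  shows "card (below y) + card (above y) = card P + 2"
proof -
  have "finite (below y)" "finite (above y)" using fin by (auto simp: below_def above_def)
  then show ?thesis
    using card_Un_Int[of "below y" "above y"] below_Un_above below_Int_above[OF assms] assms by auto
qed

lemma empty_triangles_below:
  assumes "y \<in> P" "y \<noteq> x"
  shows "empty_triangles (below y) \<subseteq> empty_triangles P"
proof (rule empty_triangles_cut[OF below_subset])
  let ?h = "normal (slope y)"
  show "?h \<noteq> 0" using d_neq_0[OF assms] by (simp add: normal_eq_0)
  show "?h \<bullet> p \<le> ?h \<bullet> x" if "p \<in> below y" for p
    using that inner_normal_sign(1)[of p] by (auto simp: below_def)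
  show "p \<in> below y" if "p \<in> P" "?h \<bullet> p < ?h \<bullet> x" for p
    using that inner_normal_sign(1)[of p "slope y"] by (cases "p = x") (simp_all add: below_def)
qed

lemma empty_triangles_above:
  assumes "y \<in> P" "y \<noteq> x"
  shows "empty_triangles (above y) \<subseteq> empty_triangles P"
proof (rule empty_triangles_cut[OF above_subset])
  let ?h = "normal (slope y)"
  show "- ?h \<noteq> 0" using d_neq_0[OF assms] by (simp add: normal_eq_0)
  show "- ?h \<bullet> p \<le> - ?h \<bullet> x" if "p \<in> above y" for p
    using that inner_normal_sign(2)[of p] by (auto simp: above_def)
  show "p \<in> above y" if "p \<in> P" "- ?h \<bullet> p < - ?h \<bullet> x" for p
    using that inner_normal_sign(2)[of p "slope y"] by (cases "p = x") (simp_all add: above_def)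
qed

lemma empty_triangles_remove:
  assumes "y \<in> P" "y \<noteq> x"
  shows "empty_triangles (P - {x}) \<subseteq> empty_triangles P"
proof (rule empty_triangles_cut[of _ _ "- d" "- d \<bullet> x"])
  show "- d \<bullet> p \<le> - d \<bullet> x" if "p \<in> P - {x}" for p
    using that pos[of p] by (simp add: inner_diff_right)
qed (use d_neq_0[OF assms] in auto)

lemma plane_connectable_below_above:
  assumes "\<And>e. e \<in> E \<Longrightarrow> card e = 2" "y \<in> P" "y \<noteq> x"
    and "plane_connectable E (below y)" "plane_connectable E (above y)"
  shows "plane_connectable E P"
proof -
  let ?h = "normal (slope y)"
  have "plane_connectable E (below y \<union> above y)"
  proof (rule plane_connectable_split[where h = ?h and b = "?h \<bullet> x" and x = x and y = y])
    show "?h \<bullet> z \<le> ?h \<bullet> x" if "z \<in> below y" for z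
      using that inner_normal_sign(1)[of z] by (auto simp: below_def)
    show "?h \<bullet> z \<ge> ?h \<bullet> x" if "z \<in> above y" for z
      using that inner_normal_sign(2)[of z] by (auto simp: above_def)
    show "{z \<in> below y \<union> above y. ?h \<bullet> z = ?h \<bullet> x} \<subseteq> {x, y}"
      using inner_normal_sign(3)[of _ "slope y"] slope_inj assms by (auto simp: below_Un_above)
  qed (use assms in \<open>auto simp: below_def above_def\<close>)
  then show ?thesis by (simp add: below_Un_above)
qed

text \<open>The edges of the hull of \<open>P - {x}\<close> that are visible from \<open>x\<close>; the line through such
  an edge is written as \<open>g \<bullet> (z - x) = 1\<close>.\<close>

definition visible_edge :: "real^2 \<Rightarrow> real^2 \<Rightarrow> bool" where
  "visible_edge p q \<longleftrightarrow> p \<in> P - {x} \<and> q \<in> P - {x} \<and> p \<noteq> q \<and>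
     (\<exists>g. g \<bullet> (p - x) = 1 \<and> g \<bullet> (q - x) = 1 \<and> (\<forall>r\<in>P - {x}. g \<bullet> (r - x) \<ge> 1))"

lemma ex_visible_edge:
  assumes "p0 \<in> P - {x}" "slope p0 < t0" "q0 \<in> P - {x}" "t0 < slope q0"
    and "\<And>z. z \<in> P - {x} \<Longrightarrow> slope z \<noteq> t0"
  shows "\<exists>p q. visible_edge p q \<and> slope p < t0 \<and> t0 < slope q"
proof -
  \<comment> \<open>In the projective coordinates \<open>(slope p, 1 / (d \<bullet> (p - x)))\<close> the visible edges
    form the upper hull.\<close>
  define w where "w = (\<lambda>p. 1 / (d \<bullet> (p - x)))"
  obtain p q A B where p: "p \<in> P - {x}" and q: "q \<in> P - {x}"
    and t: "slope p < t0" "t0 < slope q"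
    and e: "w p = A + B * slope p" "w q = A + B * slope q"
    and le: "\<And>z. z \<in> P - {x} \<Longrightarrow> w z \<le> A + B * slope z"
    using supporting_pair[of "P - {x}" p0 slope t0 q0 w] fin assms by blast
  \<comment> \<open>Multiplying \<open>w z = A + B * slope z\<close> by the positive number
    \<open>d \<bullet> (z - x)\<close> turns it into \<open>g \<bullet> (z - x) = 1\<close>.\<close>
  define g where "g = A *\<^sub>R d + B *\<^sub>R perp d"
  have g: "g \<bullet> (z - x) = (A + B * slope z) * (d \<bullet> (z - x))" and
    w1: "w z * (d \<bullet> (z - x)) = 1" if "z \<in> P - {x}" for z
  proof -
    have a: "d \<bullet> (z - x) > 0" using pos[of z] that by auto
    then show "w z * (d \<bullet> (z - x)) = 1" by (simp add: w_def)
    have "slope z * (d \<bullet> (z - x)) = perp d \<bullet> (z - x)" using a by (simp add: slope_def)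
    then show "g \<bullet> (z - x) = (A + B * slope z) * (d \<bullet> (z - x))"
      by (simp add: g_def inner_add_left distrib_right)
  qed
  have "g \<bullet> (r - x) \<ge> 1" if r: "r \<in> P - {x}" for r
    using mult_right_mono[OF le[OF r], of "d \<bullet> (r - x)"] pos[of r] r g[OF r] w1[OF r] by auto
  then have "visible_edge p q"
    unfolding visible_edge_def using p q t e g[OF p] g[OF q] w1[OF p] w1[OF q]
    by (intro conjI exI[of _ g]) auto
  then show ?thesis using t by blast
qed

text \<open>The line through \<open>p\<close> and \<open>q\<close> has the triangle on one side and
  all points except \<open>x\<close> on the other; \<open>x\<close> is a vertex of the
  triangle.\<close>

lemma visible_edge_empty:
  assumes "visible_edge p q"
  shows "{x, p, q} \<in> empty_triangles P"
proof -
  obtain g where g: "g \<bullet> (p - x) = 1" "g \<bullet> (q - x) = 1" "\<And>r. r \<in> P - {x} \<Longrightarrow> g \<bullet> (r - x) \<ge> 1"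
    and pq: "p \<in> P" "p \<noteq> x" "q \<in> P" "q \<noteq> x" "p \<noteq> q"
    using assms by (auto simp: visible_edge_def)
  have t: "{x, p, q} \<subseteq> P" "card {x, p, q} = 3" using pq x by auto
  have "g \<noteq> 0" using g(1) by auto
  have "convex hull {x, p, q} \<subseteq> {z. g \<bullet> z \<le> g \<bullet> x + 1}"
    by (rule hull_minimal) (use g in \<open>auto simp: convex_halfspace_le inner_diff_right\<close>)
  then have "interior (convex hull {x, p, q}) \<subseteq> {z. g \<bullet> z < g \<bullet> x + 1}"
    using interior_mono interior_halfspace_le[OF \<open>g \<noteq> 0\<close>] by metis
  then have "r \<notin> interior (convex hull {x, p, q})" if "r \<in> P" for r
    using triangle_vertex_not_interior[OF gp t, of x] g(3)[of r] that by (cases "r = x") (auto simp: inner_diff_right)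
  then show ?thesis using pq x by (auto simp: empty_triangles_def)
qed

end

section \<open>The two inductions on the number of points\<close>

text \<open>Cutting through \<open>x\<close> and a point that is not angularly extreme gives two
  smaller sets. Their empty triangles are empty in \<open>P\<close>, so the hypothesis at
  \<open>x\<close> survives.\<close>

lemma plane_connectable_star:
  assumes "hull_vertex P x d" "card P \<ge> 3" and E: "\<And>e. e \<in> E \<Longrightarrow> card e = 2"
    and "\<And>t. t \<in> disconnected_empty_triangles P E \<Longrightarrow> x \<notin> t"
  shows "plane_connectable E P"
  using assms(1,2,4)
proof (induction "card P" arbitrary: P rule: less_induct)
  case (less P)
  interpret hull_vertex P x d by fact
  show ?case
  proof (cases "card P = 3")
    case True
    have "P \<in> empty_triangles P"
      using triangle_vertex_not_interior[OF gp _ True] True by (auto simp: empty_triangles_def)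
    then have "graph_connected P (induced_edges E P)"
      using less.prems(3)[of P] x by (auto simp: disconnected_empty_triangles_def)
    then show ?thesis using plane_connectable_triangle[OF E gp True] by simp
  next
    case False
    then have "card P \<ge> 4" using less.prems(2) by simp
    then have fin': "finite (P - {x})" and ne: "P - {x} \<noteq> {}"
      using fin x card_mono[of "{x}" P] by auto
    obtain a where a: "a \<in> P - {x}" "\<And>p. p \<in> P - {x} \<Longrightarrow> slope p \<le> slope a"
      using ex_maximizer[OF fin' ne, of slope] by blast
    obtain b where b: "b \<in> P - {x}" "\<And>p. p \<in> P - {x} \<Longrightarrow> slope b \<le> slope p"
      using ex_maximizer[OF fin' ne, of "\<lambda>p. - slope p"] by auto
    \<comment> \<open>A fourth point \<open>y\<close> strictly between the extremes makes both parts
      proper, each with at least three points.\<close>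
    have "card {x, a, b} \<le> 3" by (simp add: card_insert_if)
    then have "\<not> P \<subseteq> {x, a, b}"
      using \<open>card P \<ge> 4\<close> card_mono[of "{x, a, b}" P] by auto
    then obtain y where y: "y \<in> P" "y \<noteq> x" "y \<noteq> a" "y \<noteq> b" by blast
    have "slope y \<noteq> slope a" "slope b \<noteq> slope y"
      using a(1) b(1) y slope_inj by (metis DiffE insertI1)+
    moreover have "slope y \<le> slope a" "slope b \<le> slope y" using a(2) b(2) y by auto
    ultimately have sa: "slope y < slope a" and sb: "slope b < slope y" by linarith+
    have "a \<notin> below y" "b \<notin> above y" using a(1) b(1) sa sb by (auto simp: below_def above_def)
    then have sub: "below y \<subset> P" "above y \<subset> P"
      using a(1) b(1) below_subset[of y] above_subset[of y] by auto
    have "{x, b, y} \<subseteq> below y" "{x, a, y} \<subseteq> above y"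
      using a(1) b(1) y sa sb by (auto simp: below_def above_def)
    moreover have "card {x, b, y} = 3" "card {x, a, y} = 3" using a(1) b(1) y by auto
    moreover have "finite (below y)" "finite (above y)" using sub fin finite_subset by blast+
    ultimately have c3: "card (below y) \<ge> 3" "card (above y) \<ge> 3" by (metis card_mono)+
    have lt: "card (below y) < card P" "card (above y) < card P"
      using sub fin by (auto intro: psubset_card_mono)
    have xin: "x \<in> below y" "x \<in> above y" by (auto simp: below_def above_def)
    have "plane_connectable E (below y)"
      using disconnected_empty_triangles_mono[OF empty_triangles_below[OF y(1,2)], of E]
      by (intro less.hyps lt c3 subset below_subset xin less.prems(3)) auto
    moreover have "plane_connectable E (above y)"
      using disconnected_empty_triangles_mono[OF empty_triangles_above[OF y(1,2)], of E]
      by (intro less.hyps lt c3 subset above_subset xin less.prems(3)) auto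
    ultimately show ?thesis using plane_connectable_below_above[OF E y(1,2)] by blast
  qed
qed

context hull_vertex
begin

text \<open>Induction step at a fixed hull vertex; \<open>IH\<close> is applied to
  \<open>P - {x}\<close> and to the two parts of a cut.\<close>

lemma plane_connectable_step:
  assumes E: "\<And>e. e \<in> E \<Longrightarrow> card e = 2" and n: "card P \<ge> 3"
    and s: "s_number P E \<le> card P - 3"
    and IH: "\<And>S. S \<subset> P \<Longrightarrow> card S \<ge> 3 \<Longrightarrow> s_number S E \<le> card S - 3 \<Longrightarrow> plane_connectable E S"
  shows "plane_connectable E P"
proof (rule ccontr)
  assume not: "\<not> plane_connectable E P"
  let ?D = "\<lambda>S. disconnected_empty_triangles S E"
  have finD: "finite (?D S)" if "S \<subseteq> P" for S
    using finite_disconnected_empty_triangles finite_subset[OF that fin] .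
  obtain t where t: "t \<in> ?D P" "x \<in> t"
    using plane_connectable_star[OF hull_vertex_axioms n E] not by blast
  have s1: "s_number P E \<ge> 1"
    using t(1) finD[of P] by (auto simp: s_number_def Suc_le_eq card_gt_0_iff)
  \<comment> \<open>The subtraction is truncated, so a positive count forces a fourth point;
    removing \<open>x\<close> then lowers both sides of the bound \<open>s\<close>.\<close>
  then have n4: "card P \<ge> 4" using s n by simp
  have fin': "finite (P - {x})" and ne: "P - {x} \<noteq> {}"
    using n4 fin x card_mono[of "{x}" P] by auto
  then obtain p0 where p0: "p0 \<in> P" "p0 \<noteq> x" by blast
  have "?D (P - {x}) \<subseteq> ?D P"
    by (rule disconnected_empty_triangles_mono[OF empty_triangles_remove[OF p0]])
  moreover have "t \<notin> ?D (P - {x})"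
    using t(2) by (auto simp: disconnected_empty_triangles_def empty_triangles_def)
  ultimately have "?D (P - {x}) \<subset> ?D P" using t(1) by blast
  then have "s_number (P - {x}) E < s_number P E"
    unfolding s_number_def by (rule psubset_card_mono[OF finD[OF subset_refl]])
  moreover have cx: "card (P - {x}) = card P - 1" using x fin by simp
  ultimately have pcx: "plane_connectable E (P - {x})"
    using s s1 n4 x by (intro IH) auto

  \<comment> \<open>Otherwise the edge from \<open>x\<close> could be attached to the plane subgraph
    on \<open>P - {x}\<close>, with \<open>g\<close> as height.\<close>
  have nonadj: "{x, p} \<notin> E \<and> {x, q} \<notin> E" if pq: "visible_edge p q" for p q
  proof -
    obtain g where g: "g \<bullet> (p - x) = 1" "g \<bullet> (q - x) = 1" "\<And>r. r \<in> P - {x} \<Longrightarrow> g \<bullet> (r - x) \<ge> 1"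
      and pq': "p \<in> P - {x}" "q \<in> P - {x}"
      using pq by (auto simp: visible_edge_def)
    have "{x, v} \<notin> E" if v: "v \<in> P - {x}" "g \<bullet> (v - x) = 1" for v
    proof
      assume "{x, v} \<in> E"
      moreover have "g \<bullet> v \<le> g \<bullet> z" if "z \<in> P - {x}" for z
        using g(3)[OF that] v(2) by (simp add: inner_diff_right)
      moreover have "g \<bullet> x < g \<bullet> v" using v(2) by (simp add: inner_diff_right)
      ultimately have "plane_connectable E (insert x (P - {x}))"
        using v(1) general_position_subset[OF gp]
        by (intro plane_connectable_pendant[OF E _ pcx, where h = g and v = v]) auto
      then show False using not x by (simp add: insert_absorb)
    qed
    then show ?thesis using g pq' by blast
  qed
  have disc: "{x, p, q} \<in> ?D P" if pq: "visible_edge p q" for p q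
  proof -
    have "{x, x} \<notin> E" using E[of "{x, x}"] by auto
    then have "\<not> graph_connected {x, p, q} (induced_edges E {x, p, q})"
      using nonadj[OF pq] pq
      by (intro not_graph_connected_isolated[of x _ p]) (auto simp: visible_edge_def induced_edges_def)
    then show ?thesis
      using visible_edge_empty[OF pq] by (simp add: disconnected_empty_triangles_def)
  qed

  \<comment> \<open>For the j-th point \<open>y\<close>, \<open>strictly_below y\<close> has
    \<open>j - 1\<close> elements.\<close>
  have claim: "y \<in> P - {x} \<Longrightarrow> card (strictly_below y) \<le> s_number (below y) E" for y
  proof (induction "card (strictly_below y)" arbitrary: y rule: less_induct)
    case (less y)
    then have y: "y \<in> P" "y \<noteq> x" by auto
    have finb: "finite (strictly_below z)" for z using fin by (simp add: strictly_below_def)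
    show ?case
    proof (cases "strictly_below y = {}")
      case False
      \<comment> \<open>The predecessor of \<open>y\<close> in angular order.\<close>
      then obtain z where z: "z \<in> strictly_below y"
        and zmax: "\<And>p. p \<in> strictly_below y \<Longrightarrow> slope p \<le> slope z"
        using ex_maximizer[OF finb, of y slope] by blast
      have zP: "z \<in> P" "z \<noteq> x" and zy: "slope z < slope y" using z by (auto simp: strictly_below_def)
      have "strictly_below y = insert z (strictly_below z)"
        using z zmax slope_inj[of _ z] zP zy by (force simp: strictly_below_def)
      moreover have "z \<notin> strictly_below z" by (simp add: strictly_below_def)
      ultimately have card_y: "card (strictly_below y) = Suc (card (strictly_below z))"
        using finb by simp
      have IHz: "card (strictly_below z) \<le> s_number (below z) E"
        using less.hyps[of z] card_y zP by simp
      have gap: "slope p \<le> slope z \<or> slope y \<le> slope p" if "p \<in> P - {x}" for p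
        using zmax[of p] that by (force simp: strictly_below_def)
      \<comment> \<open>Any slope strictly inside the gap would do, since no point attains
        it.\<close>
      define t0 where "t0 = (slope z + slope y) / 2"
      have t0: "slope z < t0" "t0 < slope y" using zy by (auto simp: t0_def)
      have "\<exists>p q. visible_edge p q \<and> slope p < t0 \<and> t0 < slope q"
        using t0 zP y gap by (intro ex_visible_edge[of z _ y]) force+
      then obtain p q where pq: "visible_edge p q" "slope p < t0" "t0 < slope q" by blast
      have pqP: "p \<in> P" "p \<noteq> x" "q \<in> P" "q \<noteq> x" using pq(1) by (auto simp: visible_edge_def)
      have sp: "slope p \<le> slope z" and sq: "slope y \<le> slope q"
        using gap[of p] gap[of q] pqP pq t0 by auto
      have sub: "?D (below z) \<subseteq> ?D (below y)"
      proof
        fix u assume u: "u \<in> ?D (below z)"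
        have "below z \<subseteq> below y" using zy by (auto simp: below_def)
        then show "u \<in> ?D (below y)"
          using u empty_triangles_below[OF zP] below_subset empty_triangles_restrict[of u P "below y"]
          unfolding disconnected_empty_triangles_def empty_triangles_def by blast
      qed
      show ?thesis
      proof (cases "q = y")
        case True
        \<comment> \<open>The visible triangle uses \<open>y\<close>, hence is new compared with
          \<open>below z\<close>.\<close>
        have "{x, p, q} \<subseteq> below y"
          using True pqP sp zy by (auto simp: below_def)
        then have "{x, p, q} \<in> ?D (below y)"
          using disc[OF pq(1)] empty_triangles_restrict[OF _ _ below_subset]
          by (auto simp: disconnected_empty_triangles_def)
        moreover have "{x, p, q} \<notin> ?D (below z)"
          using True y zy
          by (auto simp: disconnected_empty_triangles_def empty_triangles_def below_def)
        ultimately have "?D (below z) \<subset> ?D (below y)" using sub by blast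
        then have "s_number (below z) E < s_number (below y) E"
          unfolding s_number_def by (rule psubset_card_mono[OF finD[OF below_subset]])
        then show ?thesis using IHz card_y by simp
      next
        case False
        then have sq': "slope y < slope q" using sq slope_inj[of y q] y pqP by force
        show ?thesis
        proof (rule ccontr)
          assume "\<not> ?thesis"
          then have lt: "s_number (below y) E < card (strictly_below y)" by simp
          have "s_number (below z) E \<le> s_number (below y) E"
            unfolding s_number_def by (rule card_mono[OF finD[OF below_subset] sub])
          \<comment> \<open>Failure for \<open>y\<close> together with the bound for
            \<open>z\<close> pins the count down exactly, to \<open>card (below y) - 3\<close>; so
            \<open>IH\<close> applies to \<open>below y\<close>.\<close>
          then have sy: "Suc (s_number (below y) E) = card (strictly_below y)"
            using lt IHz card_y by simp
          have xyin: "x \<in> below y" "x \<in> above y" "y \<in> below y" "y \<in> above y"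
            using y by (auto simp: below_def above_def)
          have out: "q \<notin> below y" "p \<notin> above y" "q \<in> above y" "p \<in> below y"
            using pqP sq' sp zy by (auto simp: below_def above_def)
          have cb: "card (below y) = card (strictly_below y) + 2"
            and ca: "card (below y) + card (above y) = card P + 2"
            using card_below[OF y] card_below_above[OF y] by auto
          have fa: "finite (above y)" using above_subset fin finite_subset by blast
          have pcb: "plane_connectable E (below y)"
            using below_subset[of y] out pqP sy cb by (intro IH) auto
          have "{x, y, q} \<subseteq> above y" "card {x, y, q} = 3"
            using xyin out False pqP y by auto
          then have a3: "card (above y) \<ge> 3" using card_mono[OF fa] by metis
          have disj: "?D (below y) \<inter> ?D (above y) = {}"
          proof -
            have False if "u \<in> ?D (below y)" "u \<in> ?D (above y)" for u
            proof -
              have "u \<subseteq> {x, y}" "card u = 3"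
                using that below_Int_above[OF y]
                by (auto simp: disconnected_empty_triangles_def empty_triangles_def)
              moreover have "card {x, y} \<le> 2" by (simp add: card_insert_if)
              ultimately show False using card_mono[of "{x, y}" u] by auto
            qed
            then show ?thesis by blast
          qed
          \<comment> \<open>The triangle straddles the line through \<open>x\<close> and
            \<open>y\<close>: \<open>q\<close> lies strictly above it and \<open>p\<close> strictly
            below.\<close>
          have D: "{x, p, q} \<notin> ?D (below y) \<union> ?D (above y)"
            using out by (auto simp: disconnected_empty_triangles_def empty_triangles_def)
          have "?D (below y) \<union> ?D (above y) \<subseteq> ?D P"
            using disconnected_empty_triangles_mono[OF empty_triangles_below[OF y]]
              disconnected_empty_triangles_mono[OF empty_triangles_above[OF y]] by blast
          then have "?D (below y) \<union> ?D (above y) \<subset> ?D P" using D disc[OF pq(1)] by blast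
          then have "card (?D (below y) \<union> ?D (above y)) < s_number P E"
            unfolding s_number_def by (rule psubset_card_mono[OF finD[OF subset_refl]])
          then have "s_number (below y) E + s_number (above y) E < s_number P E"
            unfolding s_number_def
            using card_Un_disjoint[OF finD[OF below_subset] finD[OF above_subset] disj] by simp
          \<comment> \<open>The uncounted triangle supplies the extra 1: the count is at most
            \<open>(card P - 3) - (card (below y) - 3) - 1\<close>, which is
            \<open>card (above y) - 3\<close>.\<close>
          then have "s_number (above y) E \<le> card (above y) - 3"
            using sy cb ca s n a3 by linarith
          then have "plane_connectable E (above y)"
            using above_subset[of y] out pqP a3 by (intro IH) auto
          then show False using plane_connectable_below_above[OF E y pcb] not by simp
        qed
      qed
    qed simp
  qed
  \<comment> \<open>For the angularly last point, the claim gives at least \<open>card P - 2\<close>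
    disconnected empty triangles, one too many.\<close>
  obtain y where y: "y \<in> P - {x}" "\<And>p. p \<in> P - {x} \<Longrightarrow> slope p \<le> slope y"
    using ex_maximizer[OF fin' ne, of slope] by blast
  have "below y = P" using y x by (auto simp: below_def)
  then show False using claim[OF y(1)] card_below[of y] y(1) s n by auto
qed

end

lemma plane_connectable_if_few_disconnected:
  assumes "finite P" "general_position P" "card P \<ge> 3" and E: "\<And>e. e \<in> E \<Longrightarrow> card e = 2"
    and "s_number P E \<le> card P - 3"
  shows "plane_connectable E P"
  using assms(1-3,5)
proof (induction P rule: finite_psubset_induct)
  case (psubset P)
  obtain x d where "hull_vertex P x d"
    using ex_hull_vertex[of P] psubset.hyps psubset.prems by fastforce
  then interpret hull_vertex P x d .
  show ?case
  proof (rule plane_connectable_step[OF E psubset.prems(2,3)])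
    fix S assume S: "S \<subset> P" "card S \<ge> 3" "s_number S E \<le> card S - 3"
    then show "plane_connectable E S"
      using general_position_subset[OF gp] by (intro psubset.IH) auto
  qed
qed

theorem theorem1:
  fixes P :: "(real^2) set" and E :: "(real^2) set set" and n :: nat
  assumes "finite P" and "card P = n" and "n \<ge> 3"
    and "general_position P"
    and "simple_graph P E"
    and "s_number P E \<le> n - 3"
  shows "\<exists>T. plane_spanning_tree P E T"
proof -
  have "plane_connectable E P"
    using assms by (intro plane_connectable_if_few_disconnected) (auto simp: simple_graph_def)
  then obtain H where H: "H \<subseteq> E" "graph_connected P H" "plane_edges H"
    by (auto simp: plane_connectable_def)
  have "simple_graph P H" using H(1) assms(5) by (auto simp: simple_graph_def)
  then obtain T where T: "T \<subseteq> H" "graph_tree P T"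
    using graph_connected_imp_spanning_tree[OF H(2)] by blast
  have "plane_edges T" using T(1) H(3) unfolding plane_edges_def by blast
  then show ?thesis using T H(1) by (auto simp: plane_spanning_tree_def)
qed

end
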